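(* Let $m_1,\ldots,m_s$ and $k_1,\ldots,k_t$ be positive integers, and put $\Lambda=\sum_{i=1}^{s}(m_i-1)$ and $\Sigma=\sum_{i=1}^{t}(k_i-1)$. If $\Sigma\le\lfloor(\Lambda+1)/2\rfloor$, then for all sufficiently large $n$ (with a threshold that may depend on the $m_i$ and $k_i$), $$R(P_n,K_{1,k_1},\ldots,K_{1,k_t},m_1K_2,\ldots,m_sK_2)=n+\Lambda.$$
   Context: All graphs are finite, simple and undirected. $P_n$ denotes the path on $n$ vertices, $K_{1,k}$ the star with $k$ edges, and $mK_2$ the disjoint union of $m$ edges (a matching of size $m$). For graphs $G_1,\ldots,G_k$, the multicolor Ramsey number $R(G_1,\ldots,G_k)$ is the smallest integer $n$ such that every coloring of the edges of the complete graph $K_n$ with $k$ colors contains a monochromatic copy of $G_i$ in color $i$ for some $1\le i\le k$ (a copy means a not necessarily induced subgraph). *)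

theory Defs
  imports Main "HOL-Library.Ramsey"
begin

text \<open>
  A finite simple undirected graph is given by a finite vertex set and a set of
  two-element subsets of it; \<^term>\<open>nsets A 2\<close> is the set of all two-element subsets of \<^term>\<open>A\<close>.
\<close>

type_synonym 'a graph = "'a set \<times> 'a set set"

abbreviation verts :: "'a graph \<Rightarrow> 'a set" where "verts \<equiv> fst"
abbreviation edges :: "'a graph \<Rightarrow> 'a set set" where "edges \<equiv> snd"

definition simple_graph :: "'a graph \<Rightarrow> bool" where
  "simple_graph G \<longleftrightarrow> finite (verts G) \<and> edges G \<subseteq> nsets (verts G) 2"

definition complete_graph :: "nat \<Rightarrow> nat graph" where
  "complete_graph n = ({..<n}, nsets {..<n} 2)"

definition path_graph :: "nat \<Rightarrow> nat graph" where
  "path_graph n = ({..<n}, {{i, Suc i} |i. Suc i < n})"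

definition star_graph :: "nat \<Rightarrow> nat graph" where
  "star_graph k = ({..k}, {{0, i} |i. i \<in> {1..k}})"

definition matching_graph :: "nat \<Rightarrow> nat graph" where
  "matching_graph m = ({..<2 * m}, {{2 * i, 2 * i + 1} |i. i < m})"

lemma simple_complete_graph: "simple_graph (complete_graph n)"
  by (simp add: simple_graph_def complete_graph_def)

lemma simple_path_graph: "simple_graph (path_graph n)"
  by (auto simp: simple_graph_def path_graph_def nsets_def)

lemma simple_star_graph: "simple_graph (star_graph k)"
  by (auto simp: simple_graph_def star_graph_def nsets_def)

lemma simple_matching_graph: "simple_graph (matching_graph m)"
  by (auto simp: simple_graph_def matching_graph_def nsets_def)

text \<open>Copies are not required to be induced.\<close>

definition contains_copy :: "'a graph \<Rightarrow> 'b graph \<Rightarrow> bool" where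
  "contains_copy G H \<longleftrightarrow>
     (\<exists>f. inj_on f (verts H) \<and> f ` verts H \<subseteq> verts G \<and> (\<forall>e\<in>edges H. f ` e \<in> edges G))"

definition color_class :: "'a graph \<Rightarrow> ('a set \<Rightarrow> nat) \<Rightarrow> nat \<Rightarrow> 'a graph" where
  "color_class G c i = (verts G, {e \<in> edges G. c e = i})"

text \<open>The colors are the positions \<open>0, \<dots>, length Gs - 1\<close> of the list of graphs.\<close>

definition ramsey_arrow :: "nat \<Rightarrow> 'a graph list \<Rightarrow> bool" where
  "ramsey_arrow n Gs \<longleftrightarrow>
     (\<forall>c. (\<forall>e\<in>edges (complete_graph n). c e < length Gs) \<longrightarrow>
        (\<exists>i<length Gs. contains_copy (color_class (complete_graph n) c i) (Gs ! i)))"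

definition ramsey_number :: "'a graph list \<Rightarrow> nat" where
  "ramsey_number Gs = (LEAST n. ramsey_arrow n Gs)"

end

theory Submission
  imports Defs
begin

text \<open>
  Lower bound: on fewer than \<open>n + \<Lambda>\<close> vertices, keep at most \<open>n - 1\<close> vertices as a clique in the
  path color and split the at most \<open>\<Lambda>\<close> others into blocks of at most \<open>m\<^sub>i - 1\<close> vertices; every
  edge that leaves the clique gets the matching color of the block of its larger endpoint.  The
  block covers all edges of its color, so there are at most \<open>m\<^sub>i - 1\<close> disjoint ones; star colors
  do not occur (\<open>arrow_lower_bound\<close>).

  Upper bound: suppose that a coloring on \<open>n + \<Lambda>\<close> vertices has no forbidden star and no forbidden
  matching.  In the \<open>i\<close>-th matching color, fewer than \<open>m\<^sub>i\<close> vertices have degree at least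
  \<open>2 m\<^sub>i\<close>, because \<open>m\<^sub>i\<close> of them could be matched greedily into the rest
  (\<open>matching_from_large_degrees\<close>).  Deleting these vertices for all \<open>i\<close> costs at most \<open>\<Lambda>\<close>
  vertices.  A vertex among the remaining ones, of which there are at least \<open>n\<close>, has boundedly many
  neighbors in each star color and in each matching color, so it is joined in the path color to all
  but a bounded number \<open>D\<close> of them.  Once \<open>n\<close> is large compared with \<open>D\<close>, such a graph has a
  Hamiltonian path (\<open>path_in_dense_relation\<close>).
\<close>

section \<open>Paths in almost complete graphs\<close>

text \<open>
  A path that misses some vertex can always be lengthened.  Either an outside vertex is joined to
  its first vertex, or all outside vertices are non-neighbors of that vertex; then at most \<open>D\<close>
  vertices are outside, the path has more than \<open>2 D + 1\<close> vertices, and an outside vertex \<open>w\<close> can be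
  inserted between two consecutive ones, since its at most \<open>D\<close> non-neighbors spoil at most
  \<open>2 D\<close> gaps.
\<close>

lemma path_in_dense_relation:
  assumes fin: "finite V"
    and sym: "\<And>u v. R u v \<Longrightarrow> R v u"
    and dense: "\<And>v. v \<in> V \<Longrightarrow> card {u \<in> V. \<not> R v u} \<le> D"
    and large: "3 * D + 2 \<le> card V"
    and "n \<le> card V"
  shows "\<exists>xs. distinct xs \<and> set xs \<subseteq> V \<and> length xs = n \<and> successively R xs"
  using \<open>n \<le> card V\<close>
proof (induction n)
  case 0
  show ?case by (intro exI[of _ "[]"]) auto
next
  case (Suc n)
  then obtain xs where xs: "distinct xs" "set xs \<subseteq> V" "length xs = n" "successively R xs"
    by auto
  have card_xs: "card (set xs) = n"
    using xs by (simp add: distinct_card)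
  have "set xs \<noteq> V"
    using card_xs Suc.prems by auto
  then obtain w where w: "w \<in> V" "w \<notin> set xs"
    using xs(2) by blast
  show ?case
  proof (cases "\<exists>u \<in> V - set xs. xs = [] \<or> R u (hd xs)")
    case True
    then obtain u where u: "u \<in> V" "u \<notin> set xs" "xs = [] \<or> R u (hd xs)" by auto
    show ?thesis
      using xs u by (intro exI[of _ "u # xs"]) (auto simp: successively_Cons)
  next
    case False
    then have ne: "xs \<noteq> []" and "V - set xs \<subseteq> {u \<in> V. \<not> R (hd xs) u}"
      using w sym by blast+
    then have "card (V - set xs) \<le> D"
      using card_mono[of "{u \<in> V. \<not> R (hd xs) u}" "V - set xs"] dense[of "hd xs"] fin xs(2)
        hd_in_set[OF ne] by fastforce
    then have n_large: "2 * D + 2 \<le> n"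
      using card_Diff_subset[of "set xs" V] xs(2) card_xs large by simp
    define B where "B = {j. j < n \<and> \<not> R w (xs ! j)}"
    have finB: "finite B" by (simp add: B_def)
    have "inj_on ((!) xs) B"
      using xs by (auto simp: inj_on_def B_def nth_eq_iff_index_eq)
    moreover have "(!) xs ` B \<subseteq> {u \<in> V. \<not> R w u}"
      using xs by (auto simp: B_def)
    ultimately have cardB: "card B \<le> D"
      using card_inj_on_le[of "(!) xs" B "{u \<in> V. \<not> R w u}"] dense[OF w(1)] fin by auto
    \<comment> \<open>the gaps between positions \<open>j\<close> and \<open>j + 1\<close> next to a non-neighbor of \<open>w\<close>\<close>
    let ?C = "B \<union> (\<lambda>j. j - 1) ` B"
    have "card ?C \<le> 2 * D"
      using card_Un_le[of B "(\<lambda>j. j - 1) ` B"] card_image_le[OF finB, of "\<lambda>j. j - 1"] cardB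
      by linarith
    then have "\<not> {..<n - 1} \<subseteq> ?C"
      using card_mono[of ?C "{..<n - 1}"] finB n_large by auto
    then obtain j where "j < n - 1" "j \<notin> ?C" by auto
    moreover from this have "Suc j \<notin> B" by force
    ultimately have j: "Suc j < n" "R w (xs ! j)" "R w (xs ! Suc j)"
      by (auto simp: B_def)
    have "xs = take j xs @ xs ! j # xs ! Suc j # drop (Suc (Suc j)) xs"
      using j(1) xs(3) by (simp add: Cons_nth_drop_Suc)
    with j(2,3) obtain ys u v zs where eq: "xs = ys @ u # v # zs" and uv: "R w u" "R w v"
      by blast
    let ?xs = "ys @ u # w # v # zs"
    have "successively R ?xs"
      using xs(4) uv sym unfolding eq by (auto simp: successively_append_iff)
    moreover have "distinct ?xs" "set ?xs = insert w (set xs)" "length ?xs = Suc n"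
      using xs(1,3) w(2) unfolding eq by auto
    ultimately show ?thesis
      using xs(2) w(1) by (intro exI[of _ ?xs]) auto
  qed
qed

lemma contains_path_if_successively:
  assumes "distinct xs" "set xs \<subseteq> verts G" "successively (\<lambda>u v. {u, v} \<in> edges G) xs"
  shows "contains_copy G (path_graph (length xs))"
  unfolding contains_copy_def path_graph_def
  using assms
  by (intro exI[of _ "(!) xs"])
     (auto simp: inj_on_def nth_eq_iff_index_eq successively_conv_nth)

section \<open>Stars and matchings forced by degrees\<close>

definition nbrs :: "'a graph \<Rightarrow> 'a \<Rightarrow> 'a set" where
  "nbrs G v = {u. {v, u} \<in> edges G}"

lemma edge_in_simple_graph:
  assumes "simple_graph G" "{u, v} \<in> edges G"
  shows "u \<in> verts G" "v \<in> verts G" "u \<noteq> v"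
proof -
  have "{u, v} \<in> nsets (verts G) 2"
    using assms unfolding simple_graph_def by blast
  then show "u \<in> verts G" "v \<in> verts G" "u \<noteq> v"
    by (auto simp: nsets_def card_insert_if split: if_splits)
qed

lemma nbrs_subset: "simple_graph G \<Longrightarrow> nbrs G v \<subseteq> verts G - {v}"
  using edge_in_simple_graph[of G v] by (auto simp: nbrs_def)

lemma finite_nbrs: "simple_graph G \<Longrightarrow> finite (nbrs G v)"
  by (meson finite_Diff finite_subset nbrs_subset simple_graph_def)

lemma star_from_degree:
  assumes G: "simple_graph G" and "v \<in> verts G" and "k \<le> card (nbrs G v)"
  shows "contains_copy G (star_graph k)"
proof -
  obtain S where S: "S \<subseteq> nbrs G v" "card S = k"
    using obtain_subset_with_card_n[OF assms(3)] by auto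
  have "finite S" using S(1) finite_nbrs[OF G] finite_subset by blast
  then obtain h where h: "bij_betw h {1..k} S"
    using S(2) ex_bij_betw_nat_finite_1 by blast
  have hS: "h i \<in> nbrs G v" if "i \<in> {1..k}" for i
    using h S that by (auto simp: bij_betw_def)
  define f where "f = h(0 := v)"
  have "inj_on f {..k}"
  proof -
    have "{..k} = insert 0 {1..k}" by auto
    moreover have "inj_on f {1..k}"
      using h inj_on_cong[of "{1..k}" f h] by (simp add: f_def bij_betw_def)
    moreover have "f 0 \<notin> f ` {1..k}"
      using hS nbrs_subset[OF G, of v] by (fastforce simp: f_def)
    ultimately show ?thesis by simp
  qed
  moreover have "f i \<in> verts G" if "i \<le> k" for i
    using hS[of i] nbrs_subset[OF G, of v] assms(2) that by (cases "i = 0") (auto simp: f_def)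
  moreover have "f ` {0, i} \<in> edges G" if "i \<in> {1..k}" for i
    using hS[OF that] that by (auto simp: f_def nbrs_def insert_commute)
  ultimately show ?thesis
    unfolding contains_copy_def star_graph_def by (intro exI[of _ f]) auto
qed

text \<open>
  The vertices of \<open>A\<close> are matched one after another to vertices outside \<open>A\<close>: at each step the
  \<open>m\<close> vertices of \<open>A\<close> and the fewer than \<open>m\<close> partners used so far cannot exhaust \<open>2 m\<close> neighbors.
\<close>

lemma matching_from_large_degrees:
  assumes G: "simple_graph G" and A: "A \<subseteq> verts G" "card A = m"
    and deg: "\<And>v. v \<in> A \<Longrightarrow> 2 * m \<le> card (nbrs G v)"
  shows "contains_copy G (matching_graph m)"
proof -
  have finA: "finite A"
    using A(1) G finite_subset by (auto simp: simple_graph_def)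
  obtain a where "bij_betw a {..<m} A"
    using ex_bij_betw_nat_finite[OF finA] A(2) by (auto simp: atLeast0LessThan)
  then have a: "inj_on a {..<m}" "a ` {..<m} = A"
    by (auto simp: bij_betw_def)
  have "\<exists>b. inj_on b {..<j} \<and> (\<forall>i<j. b i \<in> nbrs G (a i) - A)" if "j \<le> m" for j
    using that
  proof (induction j)
    case 0
    show ?case by auto
  next
    case (Suc j)
    then obtain b where b: "inj_on b {..<j}" "\<forall>i<j. b i \<in> nbrs G (a i) - A"
      by auto
    have "card (A \<union> b ` {..<j}) \<le> m + j"
      using card_Un_le[of A "b ` {..<j}"] card_image_le[of "{..<j}" b] A(2) by simp
    moreover have "a j \<in> A"
      using a(2) Suc.prems by auto
    ultimately have "card (A \<union> b ` {..<j}) < card (nbrs G (a j))"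
      using deg[of "a j"] Suc.prems by linarith
    then have "\<not> nbrs G (a j) \<subseteq> A \<union> b ` {..<j}"
      using card_mono[of "A \<union> b ` {..<j}" "nbrs G (a j)"] finA by auto
    then obtain w where w: "w \<in> nbrs G (a j)" "w \<notin> A" "w \<notin> b ` {..<j}"
      by auto
    have "inj_on (b(j := w)) {..<Suc j}"
      using b(1) w(3) by (auto simp: lessThan_Suc inj_on_def)
    then show ?case
      using b(2) w by (intro exI[of _ "b(j := w)"] conjI) (assumption, auto simp: less_Suc_eq)
  qed
  from this[of m] obtain b where
    b: "inj_on b {..<m}" "\<And>i. i < m \<Longrightarrow> b i \<in> nbrs G (a i) - A" by auto
  have aA: "a i \<in> A" if "i < m" for i
    using a(2) that by auto
  define f where "f x = (if even x then a (x div 2) else b (x div 2))" for x :: nat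
  have "inj_on f {..<2 * m}"
  proof (rule inj_onI)
    fix x y assume xy: "x \<in> {..<2 * m}" "y \<in> {..<2 * m}" "f x = f y"
    then have lt: "x div 2 < m" "y div 2 < m" by auto
    have par: "even x \<longleftrightarrow> even y"
      using xy(3) aA[OF lt(1)] aA[OF lt(2)] b(2)[OF lt(1)] b(2)[OF lt(2)]
      by (auto simp: f_def split: if_splits)
    then have "x div 2 = y div 2"
      using xy(3) lt a(1) b(1) by (auto simp: f_def inj_on_def split: if_splits)
    then show "x = y"
      using par by (metis even_two_times_div_two odd_two_times_div_two_succ)
  qed
  moreover have "f x \<in> verts G" if "x < 2 * m" for x
  proof -
    have "x div 2 < m" using that by auto
    then have "a (x div 2) \<in> verts G" "b (x div 2) \<in> verts G"
      using aA b(2) A(1) nbrs_subset[OF G, of "a (x div 2)"] by blast+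
    then show ?thesis
      by (simp add: f_def)
  qed
  moreover have "f ` {2 * i, 2 * i + 1} \<in> edges G" if "i < m" for i
    using b(2)[OF that] by (simp add: f_def nbrs_def insert_commute)
  ultimately show ?thesis
    unfolding contains_copy_def matching_graph_def by (intro exI[of _ f]) auto
qed

lemma few_large_degrees:
  assumes "simple_graph G" and "\<not> contains_copy G (matching_graph m)"
  shows "card {v \<in> verts G. 2 * m \<le> card (nbrs G v)} \<le> m - 1"
proof (rule ccontr)
  assume "\<not> ?thesis"
  then have "m \<le> card {v \<in> verts G. 2 * m \<le> card (nbrs G v)}" by simp
  from obtain_subset_with_card_n[OF this]
  obtain A where "A \<subseteq> {v \<in> verts G. 2 * m \<le> card (nbrs G v)}" "card A = m"
    by blast
  then show False
    using matching_from_large_degrees[of G A m] assms by blast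
qed

section \<open>The upper bound\<close>

lemma simple_color_class: "simple_graph G \<Longrightarrow> simple_graph (color_class G c i)"
  by (auto simp: simple_graph_def color_class_def)

text \<open>
  A vertex is a non-neighbor of itself, and in each star or matching color it keeps fewer neighbors
  than one of the numbers \<open>k\<^sub>i\<close>, \<open>2 m\<^sub>i\<close>; bounding each of these by the same sum gives \<open>D\<close>.
\<close>

lemma arrow_upper_bound:
  fixes ks ms :: "nat list"
  defines "\<Lambda> \<equiv> \<Sum>m\<leftarrow>ms. m - 1"
  defines "D \<equiv> 1 + (length ks + length ms) * (sum_list ks + 2 * sum_list ms)"
  assumes n_large: "3 * D + 2 \<le> n"
  shows "ramsey_arrow (n + \<Lambda>) (path_graph n # map star_graph ks @ map matching_graph ms)"
  unfolding ramsey_arrow_def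
proof (intro allI impI, rule ccontr)
  let ?t = "length ks" and ?s = "length ms"
  let ?Gs = "path_graph n # map star_graph ks @ map matching_graph ms"
  let ?K = "complete_graph (n + \<Lambda>)"
  fix c
  assume c: "\<forall>e\<in>edges ?K. c e < length ?Gs"
    and "\<not> (\<exists>i<length ?Gs. contains_copy (color_class ?K c i) (?Gs ! i))"
  then have avoid: "\<not> contains_copy (color_class ?K c i) (?Gs ! i)" if "i < 1 + ?t + ?s" for i
    using that by auto
  define H where "H i = color_class ?K c i" for i
  have H: "simple_graph (H i)" for i
    unfolding H_def by (intro simple_color_class simple_complete_graph)
  have vH: "verts (H i) = {..<n + \<Lambda>}" for i
    by (simp add: H_def color_class_def complete_graph_def)
  have no_path: "\<not> contains_copy (H 0) (path_graph n)"
    using avoid[of 0] by (simp add: H_def)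
  have no_star: "\<not> contains_copy (H (1 + i)) (star_graph (ks ! i))" if "i < ?t" for i
    using avoid[of "1 + i"] that by (simp add: H_def nth_append)
  have no_matching: "\<not> contains_copy (H (1 + ?t + i)) (matching_graph (ms ! i))"
    if "i < ?s" for i
    using avoid[of "1 + ?t + i"] that by (simp add: H_def nth_append)
  \<comment> \<open>the vertices to delete for the \<open>i\<close>-th matching\<close>
  define A where
    "A i = {v \<in> verts (H (1 + ?t + i)). 2 * ms ! i \<le> card (nbrs (H (1 + ?t + i)) v)}" for i
  define V where "V = {..<n + \<Lambda>} - (\<Union>i<?s. A i)"
  have finV: "finite V" by (simp add: V_def)
  have "card (\<Union>i<?s. A i) \<le> (\<Sum>i<?s. card (A i))"
    by (rule card_UN_le) simp
  also have "\<dots> \<le> (\<Sum>i<?s. ms ! i - 1)"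
    unfolding A_def by (intro sum_mono few_large_degrees H no_matching) auto
  also have "\<dots> = \<Lambda>"
    by (simp add: \<Lambda>_def sum_list_sum_nth atLeast0LessThan)
  finally have cardA: "card (\<Union>i<?s. A i) \<le> \<Lambda>" .
  have cardV: "n \<le> card V"
    using diff_card_le_card_Diff[of "\<Union>i<?s. A i" "{..<n + \<Lambda>}"] cardA
    by (simp add: V_def A_def vH)
  let ?d = "sum_list ks + 2 * sum_list ms"
  have deg: "card (nbrs (H i) v) \<le> ?d" if i: "1 \<le> i" "i < 1 + ?t + ?s" and v: "v \<in> V" for i v
  proof (cases "i \<le> ?t")
    case True
    then obtain j where j: "i = 1 + j" "j < ?t"
      using i by (metis Suc_le_eq le_Suc_ex plus_1_eq_Suc)
    have "\<not> ks ! j \<le> card (nbrs (H i) v)"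
      using star_from_degree[OF H[of i], of v "ks ! j"] no_star[OF j(2)] v j(1)
      by (auto simp: vH V_def)
    then show ?thesis
      using member_le_sum_list[of "ks ! j" ks] j(2) by simp
  next
    case False
    then obtain j where j: "i = 1 + ?t + j" "j < ?s"
      using i by (metis Suc_eq_plus1_left add.commute le_Suc_ex not_less_eq_eq nat_add_left_cancel_less)
    have "v \<notin> A j"
      using v j(2) by (auto simp: V_def)
    then have "\<not> 2 * ms ! j \<le> card (nbrs (H i) v)"
      using v by (auto simp: A_def j(1) vH V_def)
    then show ?thesis
      using member_le_sum_list[of "ms ! j" ms] j(2) by simp
  qed
  have dense: "card {u \<in> V. {v, u} \<notin> edges (H 0)} \<le> D" if v: "v \<in> V" for v
  proof -
    let ?I = "{1..<1 + ?t + ?s}"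
    have "{u \<in> V. {v, u} \<notin> edges (H 0)} \<subseteq> insert v (\<Union>i\<in>?I. nbrs (H i) v)"
    proof
      fix u assume u: "u \<in> {u \<in> V. {v, u} \<notin> edges (H 0)}"
      show "u \<in> insert v (\<Union>i\<in>?I. nbrs (H i) v)"
      proof (cases "u = v")
        case False
        then have e: "{v, u} \<in> edges ?K"
          using u v by (auto simp: complete_graph_def V_def)
        then have "c {v, u} < 1 + ?t + ?s" "c {v, u} \<noteq> 0"
          using c u by (auto simp: H_def color_class_def)
        then show ?thesis
          using e by (auto simp: nbrs_def H_def color_class_def intro!: bexI[of _ "c {v, u}"])
      qed simp
    qed
    then have "card {u \<in> V. {v, u} \<notin> edges (H 0)} \<le> card (insert v (\<Union>i\<in>?I. nbrs (H i) v))"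
      by (intro card_mono) (auto intro!: finite_nbrs H)
    also have "\<dots> \<le> 1 + card (\<Union>i\<in>?I. nbrs (H i) v)"
      using card_insert_le_m1 by (simp add: card_insert_if finite_nbrs[OF H])
    also have "card (\<Union>i\<in>?I. nbrs (H i) v) \<le> (\<Sum>i\<in>?I. card (nbrs (H i) v))"
      by (rule card_UN_le) simp
    also have "\<dots> \<le> (\<Sum>i\<in>?I. ?d)"
      by (intro sum_mono deg v) auto
    finally show ?thesis
      by (simp add: D_def)
  qed
  have "\<exists>xs. distinct xs \<and> set xs \<subseteq> V \<and> length xs = n
    \<and> successively (\<lambda>u v. {u, v} \<in> edges (H 0)) xs"
    using finV dense cardV n_large
    by (intro path_in_dense_relation[where D = D]) (auto simp: insert_commute)
  then obtain xs where xs: "distinct xs" "set xs \<subseteq> V" "length xs = n"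
    "successively (\<lambda>u v. {u, v} \<in> edges (H 0)) xs" by blast
  then have "contains_copy (H 0) (path_graph n)"
    using contains_path_if_successively[of xs "H 0"] by (auto simp: vH V_def)
  then show False
    using no_path by simp
qed

section \<open>The lower bound\<close>

text \<open>
  The partition of the vertices outside the clique into blocks, one for each matching.
\<close>

lemma block_assignment:
  fixes ms :: "nat list"
  shows "\<exists>g. (\<forall>j < (\<Sum>m\<leftarrow>ms. m - 1). g j < length ms) \<and>
    (\<forall>i < length ms. card {j. j < (\<Sum>m\<leftarrow>ms. m - 1) \<and> g j = i} \<le> ms ! i - 1)"
proof -
  let ?L = "\<Sum>m\<leftarrow>ms. m - 1"
  let ?S = "SIGMA i:{..<length ms}. {..<ms ! i - 1}"
  have "card ?S = ?L"
    by (simp add: card_SigmaI sum_list_sum_nth atLeast0LessThan)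
  then obtain h where h: "bij_betw h {..<?L} ?S"
    using ex_bij_betw_nat_finite[of ?S] by (auto simp: atLeast0LessThan)
  have hS: "h j \<in> ?S" if "j < ?L" for j
    using h that by (auto simp: bij_betw_def)
  have "card {j. j < ?L \<and> fst (h j) = i} \<le> ms ! i - 1" if "i < length ms" for i
  proof -
    have "inj_on h {j. j < ?L \<and> fst (h j) = i}"
      using h by (auto simp: bij_betw_def inj_on_def)
    moreover have "h ` {j. j < ?L \<and> fst (h j) = i} \<subseteq> {i} \<times> {..<ms ! i - 1}"
      using hS by fastforce
    ultimately show ?thesis
      using card_inj_on_le[of h _ "{i} \<times> {..<ms ! i - 1}"] by (simp add: card_cartesian_product)
  qed
  moreover have "fst (h j) < length ms" if "j < ?L" for j
    using hS[OF that] by (cases "h j") auto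
  ultimately show ?thesis
    by (intro exI[of _ "\<lambda>j. fst (h j)"]) simp
qed

text \<open>A set that meets every edge bounds the size of a matching.\<close>

lemma matching_le_cover:
  assumes "contains_copy G (matching_graph m)" and fin: "finite B"
    and p: "\<And>e. e \<in> edges G \<Longrightarrow> e \<inter> B \<noteq> {}"
  shows "m \<le> card B"
proof -
  obtain f where f: "inj_on f {..<2 * m}"
    "\<forall>e\<in>{{2 * i, 2 * i + 1} |i. i < m}. f ` e \<in> edges G"
    using assms(1) unfolding contains_copy_def matching_graph_def fst_conv snd_conv by blast
  then have "\<forall>i<m. f ` {2 * i, 2 * i + 1} \<in> edges G"
    by blast
  then have "\<forall>i<m. \<exists>x \<in> {2 * i, 2 * i + 1}. f x \<in> B"
    using p by blast
  then obtain x where x: "\<And>i. i < m \<Longrightarrow> x i \<in> {2 * i, 2 * i + 1} \<and> f (x i) \<in> B"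
    by metis
  have x_div: "x i div 2 = i" and x_lt: "x i < 2 * m" if "i < m" for i
    using x[OF that] that by auto
  have "inj_on (\<lambda>i. f (x i)) {..<m}"
  proof (rule inj_onI)
    fix i j assume ij: "i \<in> {..<m}" "j \<in> {..<m}" "f (x i) = f (x j)"
    then have "x i = x j"
      using f(1) x_lt by (auto simp: inj_on_def)
    then show "i = j"
      using x_div ij by (metis lessThan_iff)
  qed
  then have "card {..<m} \<le> card B"
    using x by (intro card_inj_on_le[OF _ _ fin]) auto
  then show ?thesis by simp
qed

text \<open>A path with at least two vertices has no isolated vertex.\<close>

lemma path_le_card:
  assumes "contains_copy G (path_graph n)" and "2 \<le> n" and "finite B"
    and "\<And>e. e \<in> edges G \<Longrightarrow> e \<subseteq> B"
  shows "n \<le> card B"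
proof -
  obtain f where f: "inj_on f {..<n}" "\<forall>e\<in>{{i, Suc i} |i. Suc i < n}. f ` e \<in> edges G"
    using assms(1) by (auto simp: contains_copy_def path_graph_def)
  then have f_edge: "f ` {i, Suc i} \<in> edges G" if "Suc i < n" for i
    using that by blast
  have "f i \<in> B" if "i < n" for i
  proof (cases i)
    case 0
    then show ?thesis using f_edge[of 0] assms(2) assms(4)[of "f ` {0, 1}"] by simp
  next
    case (Suc j)
    then show ?thesis using f_edge[of j] assms(4)[of "f ` {j, i}"] that by simp
  qed
  then have "card {..<n} \<le> card B"
    using f(1) assms(3) by (intro card_inj_on_le[of f]) auto
  then show ?thesis by simp
qed

lemma arrow_lower_bound:
  fixes ks ms :: "nat list"
  defines "\<Lambda> \<equiv> \<Sum>m\<leftarrow>ms. m - 1"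
  assumes ms_pos: "\<forall>m\<in>set ms. 1 \<le> m" and ks_pos: "\<forall>k\<in>set ks. 1 \<le> k"
    and n: "2 \<le> n" and N: "N < n + \<Lambda>"
  shows "\<not> ramsey_arrow N (path_graph n # map star_graph ks @ map matching_graph ms)"
proof
  let ?t = "length ks" and ?s = "length ms"
  let ?Gs = "path_graph n # map star_graph ks @ map matching_graph ms"
  let ?K = "complete_graph N"
  assume arrow: "ramsey_arrow N ?Gs"
  obtain g where g: "\<And>j. j < \<Lambda> \<Longrightarrow> g j < ?s"
    "\<And>i. i < ?s \<Longrightarrow> card {j. j < \<Lambda> \<and> g j = i} \<le> ms ! i - 1"
    using block_assignment[of ms] unfolding \<Lambda>_def by blast
  \<comment> \<open>The clique is \<open>{..<n - 1}\<close>; an edge that leaves it has its larger endpoint outside, and the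
    offset of that endpoint, which is below \<open>\<Lambda>\<close>, selects the block.\<close>
  define c where
    "c e = (if e \<subseteq> {..<n - 1} then 0 else 1 + ?t + g (Max e - (n - 1)))" for e :: "nat set"
  have edge: "Max e \<in> e" "n - 1 \<le> Max e" "Max e - (n - 1) < \<Lambda>"
    if "e \<in> edges ?K" "\<not> e \<subseteq> {..<n - 1}" for e
  proof -
    have e: "e \<subseteq> {..<N}" "finite e" "e \<noteq> {}"
      using that(1) by (auto simp: complete_graph_def nsets_def)
    show "Max e \<in> e"
      using e by simp
    then have "Max e < N" using e by auto
    show "n - 1 \<le> Max e"
      using that(2) e by (meson Max_ge lessThan_iff linorder_not_less order_trans subsetI)
    then show "Max e - (n - 1) < \<Lambda>"
      using \<open>Max e < N\<close> N n by linarith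
  qed
  have "\<forall>e\<in>edges ?K. c e < length ?Gs"
    using edge(3) g(1) by (auto simp: c_def)
  then obtain i where i: "i < length ?Gs" "contains_copy (color_class ?K c i) (?Gs ! i)"
    using arrow by (auto simp: ramsey_arrow_def)
  consider "i = 0" | j where "i = 1 + j" "j < ?t" | j where "i = 1 + ?t + j" "j < ?s"
  proof -
    consider "i = 0" | "1 \<le> i" "i < 1 + ?t" | "1 + ?t \<le> i" by linarith
    then show thesis
      using i(1) that by cases (auto dest!: le_Suc_ex)
  qed
  then show False
  proof cases
    case 1
    have "n \<le> card {..<n - 1}"
      using i(2) n 1
      by (intro path_le_card[of "color_class ?K c 0"])
         (auto simp: color_class_def c_def split: if_splits)
    then show False
      using n by simp
  next
    case 2
    then have "contains_copy (color_class ?K c i) (star_graph (ks ! j))"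
      using i(2) by (simp add: nth_append)
    moreover have "1 \<le> ks ! j"
      using ks_pos 2(2) by simp
    then have "{0, 1} \<in> edges (star_graph (ks ! j))"
      by (force simp: star_graph_def)
    ultimately obtain e where "e \<in> edges (color_class ?K c i)"
      unfolding contains_copy_def by blast
    then show False
      using 2 by (auto simp: color_class_def c_def split: if_splits)
  next
    case 3
    let ?B = "(+) (n - 1) ` {k. k < \<Lambda> \<and> g k = j}"
    have "contains_copy (color_class ?K c i) (matching_graph (ms ! j))"
      using i(2) 3 by (simp add: nth_append)
    moreover have "e \<inter> ?B \<noteq> {}" if "e \<in> edges (color_class ?K c i)" for e
    proof -
      have e: "e \<in> edges ?K" "c e = i"
        using that by (auto simp: color_class_def)
      then have out: "\<not> e \<subseteq> {..<n - 1}" and "g (Max e - (n - 1)) = j"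
        using 3 by (auto simp: c_def split: if_splits)
      then have "Max e \<in> ?B"
        using edge[OF e(1) out] by (intro image_eqI[of _ _ "Max e - (n - 1)"]) auto
      then show ?thesis
        using edge(1)[OF e(1) out] by blast
    qed
    ultimately have "ms ! j \<le> card ?B"
      by (intro matching_le_cover) auto
    also have "card ?B = card {k. k < \<Lambda> \<and> g k = j}"
      by (simp add: card_image)
    finally have "ms ! j \<le> ms ! j - 1"
      using g(2)[OF 3(2)] by linarith
    moreover have "1 \<le> ms ! j"
      using ms_pos 3(2) by simp
    ultimately show False by simp
  qed
qed

section \<open>The Ramsey number\<close>

theorem corollary15:
  fixes ms ks :: "nat list" and \<Lambda> \<Sigma> :: nat
  assumes ms_pos: "\<forall>m\<in>set ms. 1 \<le> m"
    and ks_pos: "\<forall>k\<in>set ks. 1 \<le> k"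
    and Lambda: "\<Lambda> = (\<Sum>m\<leftarrow>ms. m - 1)"
    and Sigma: "\<Sigma> = (\<Sum>k\<leftarrow>ks. k - 1)"
    and le: "\<Sigma> \<le> (\<Lambda> + 1) div 2"
  shows "\<exists>n0. \<forall>n\<ge>n0.
    ramsey_number (path_graph n # map star_graph ks @ map matching_graph ms) = n + \<Lambda>"
proof (intro exI allI impI)
  fix n
  assume n: "3 * (1 + (length ks + length ms) * (sum_list ks + 2 * sum_list ms)) + 2 \<le> n"
  show "ramsey_number (path_graph n # map star_graph ks @ map matching_graph ms) = n + \<Lambda>"
    unfolding ramsey_number_def
  proof (rule Least_equality)
    show "ramsey_arrow (n + \<Lambda>) (path_graph n # map star_graph ks @ map matching_graph ms)"
      unfolding Lambda using n by (rule arrow_upper_bound)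
  next
    fix N
    assume "ramsey_arrow N (path_graph n # map star_graph ks @ map matching_graph ms)"
    moreover have "2 \<le> n" using n by linarith
    ultimately show "n + \<Lambda> \<le> N"
      using arrow_lower_bound[OF ms_pos ks_pos, of n N] unfolding Lambda
      by (meson linorder_not_less)
  qed
qed

end
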